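(* Let $n\ge 2$, let $L\in\mathbb{R}^{n\times n}$ be the weighted Laplacian of an undirected connected graph on $\{1,\dots,n\}$ (so $L=L^\top$ and $0$ is a simple eigenvalue of $L$), let $d\in\mathbb{R}$, and let $x^0\in\mathbb{R}^n$ satisfy $\sum_{i=1}^n x_i^0=d$. Let $f_i:\mathbb{R}\to\mathbb{R}$, $i=1,\dots,n$, be twice continuously differentiable and strongly convex with $0<\delta_i\le f_i''(s)\le\Delta_i$ for all $s\in\mathbb{R}$, for given constants $\delta_i,\Delta_i>0$. Suppose there is $\epsilon<1$ such that for every $x\in\mathbb{R}^n$ $$-\epsilon I_{n-1}\preceq I_{n-1}-M(x)\preceq \epsilon I_{n-1},$$ where $M(x)\in\mathbb{R}^{(n-1)\times(n-1)}$ is the reduced Hessian defined in the context. Let $g(z)=\sum_{i=1}^n f_i(x_i^0+(Lz)_i)$ for $z\in\mathbb{R}^n$, let $q\in\mathbb{N}$, and let the step size $\alpha>0$ satisfy $$\alpha<\frac{2(1-\epsilon)}{(n-1)(1+\epsilon)(1-\epsilon^{q+1})}.$$ Then, for any initial condition $z(0)\in\mathbb{R}^n$, the iterates of $$z^{+}=z-\alpha A_q(z)\nabla_z g(z)$$ (with $A_q(z)$ as defined in the context) converge asymptotically to an optimal solution $z^\star$ of the problem $\min_{z\in\mathbb{R}^n} g(z)$, namely the one uniquely satisfying $\mathbf{1}_n^\top z^\star=\mathbf{1}_n^\top z(0)$.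
   Context: Weighted Laplacian: for an undirected graph on nodes $\{1,\dots,n\}$ with edge weights $w_{ij}=w_{ji}>0$ for edges $\{i,j\}$, $L_{ij}=-w_{ij}$ if $j\neq i$ is a neighbor of $i$, $L_{ii}=\sum_{j}w_{ij}$ (sum over neighbors of $i$), and $L_{ij}=0$ otherwise. Thus $L\succeq 0$ and $L\mathbf{1}_n=\mathbf{0}$, where $\mathbf{1}_n$ is the all-ones vector. $H(x)$ denotes the diagonal Hessian of $f(x)=\sum_i f_i(x_i)$, i.e. $H(x)=\mathrm{diag}(f_1''(x_1),\dots,f_n''(x_n))$. One has $\nabla_z g(z)=L\nabla f(x^0+Lz)$ and $\nabla_{zz}g(z)=LH(x^0+Lz)L$. Reduced Hessian: let $r=1/\sqrt{n(n+1+2\sqrt n)}$ and let $U\in\mathbb{R}^{n\times(n-1)}$ have entries $U_{ii}=r(n-1+\sqrt n)$ for $1\le i\le n-1$, $U_{ij}=-r$ for $1\le i,j\le n-1$, $i\ne j$, and $U_{nj}=-r(1+\sqrt n)$ for $1\le j\le n-1$. (The columns of $U$ form an orthonormal basis of the orthogonal complement of $\mathbf{1}_n$.) Then $M(x):=U^\top LH(x)LU$. For $q\in\mathbb{N}$, $A_q(z):=\sum_{p=0}^q (I_n-LH(x^0+Lz)L)^p$. $A\preceq B$ for symmetric matrices means $B-A$ is positive semidefinite. *)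

theory Defs
  imports "HOL-Analysis.Analysis"
begin

text \<open>
  The nodes \<open>1, \<dots>, n\<close> are the elements of a finite type \<open>'n\<close>, with \<open>n = CARD('n)\<close>, and the indices
  \<open>1, \<dots>, n - 1\<close> of the reduced matrices are the elements of a second finite type \<open>'m\<close>. Only the
  matrix \<open>U\<close> refers to the numbers of the indices; it takes a numbering \<open>\<nu>\<close> of \<open>'n\<close> by \<open>{1..n}\<close> and
  a numbering \<open>\<kappa>\<close> of \<open>'m\<close> by \<open>{1..n-1}\<close> as parameters.
\<close>

definition weighted_graph :: "('n \<Rightarrow> 'n \<Rightarrow> bool) \<Rightarrow> ('n \<Rightarrow> 'n \<Rightarrow> real) \<Rightarrow> bool" where
  "weighted_graph E w \<longleftrightarrow> symp E \<and> irreflp E \<and> (\<forall>i j. E i j \<longrightarrow> w i j = w j i \<and> 0 < w i j)"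

definition connected_graph :: "('n \<Rightarrow> 'n \<Rightarrow> bool) \<Rightarrow> bool" where
  "connected_graph E \<longleftrightarrow> (\<forall>i j. E\<^sup>*\<^sup>* i j)"

definition laplacian :: "('n \<Rightarrow> 'n \<Rightarrow> bool) \<Rightarrow> ('n \<Rightarrow> 'n \<Rightarrow> real) \<Rightarrow> real^'n^'n::finite" where
  "laplacian E w =
     (\<chi> i j. if i = j then (\<Sum>k | E i k. w i k) else if E i j then - w i j else 0)"

definition twice_cont_diff :: "(real \<Rightarrow> real) \<Rightarrow> bool" where
  "twice_cont_diff f \<longleftrightarrow> f differentiable_on UNIV \<and> deriv f differentiable_on UNIV \<and>
     continuous_on UNIV (deriv (deriv f))"

definition strongly_convex :: "(real \<Rightarrow> real) \<Rightarrow> bool" where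
  "strongly_convex f \<longleftrightarrow> (\<exists>m>0. convex_on UNIV (\<lambda>s. f s - m / 2 * s\<^sup>2))"

text \<open>The instance of \<open>(*)\<close> and \<open>(\<le>)\<close> at type \<open>vec\<close> is componentwise, so powers of matrices and
  the Loewner order need their own constants.\<close>

definition matpow :: "real^'n^'n \<Rightarrow> nat \<Rightarrow> real^'n^'n::finite" where
  "matpow A p = (((**) A) ^^ p) (mat 1)"

definition psd :: "real^'n^'n::finite \<Rightarrow> bool" where
  "psd A \<longleftrightarrow> transpose A = A \<and> (\<forall>v. 0 \<le> v \<bullet> (A *v v))"

definition loewner_le :: "real^'n^'n \<Rightarrow> real^'n^'n::finite \<Rightarrow> bool"  (infix "\<preceq>" 50) where
  "A \<preceq> B \<longleftrightarrow> psd (B - A)"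

definition gradient :: "('a::real_inner \<Rightarrow> real) \<Rightarrow> 'a \<Rightarrow> 'a" where
  "gradient g z = (THE D. GDERIV g z :> D)"

definition hess :: "('n \<Rightarrow> real \<Rightarrow> real) \<Rightarrow> real^'n \<Rightarrow> real^'n^'n::finite" where
  "hess f x = (\<chi> i j. if i = j then deriv (deriv (f i)) (x $ i) else 0)"

definition U_mat :: "('n::finite \<Rightarrow> nat) \<Rightarrow> ('m::finite \<Rightarrow> nat) \<Rightarrow> real^'m^'n" where
  "U_mat \<nu> \<kappa> =
     (let n = real CARD('n); r = 1 / sqrt (n * (n + 1 + 2 * sqrt n))
      in \<chi> i j. if \<nu> i = CARD('n) then - r * (1 + sqrt n)
               else if \<nu> i = \<kappa> j then r * (n - 1 + sqrt n)
               else - r)"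

definition reduced_hess ::
  "('n::finite \<Rightarrow> nat) \<Rightarrow> ('m::finite \<Rightarrow> nat) \<Rightarrow> real^'n^'n \<Rightarrow> ('n \<Rightarrow> real \<Rightarrow> real) \<Rightarrow> real^'n
     \<Rightarrow> real^'m^'m" where
  "reduced_hess \<nu> \<kappa> L f x =
     transpose (U_mat \<nu> \<kappa>) ** L ** hess f x ** L ** U_mat \<nu> \<kappa>"

definition objective ::
  "real^'n^'n \<Rightarrow> ('n \<Rightarrow> real \<Rightarrow> real) \<Rightarrow> real^'n \<Rightarrow> real^'n::finite \<Rightarrow> real" where
  "objective L f x0 z = (\<Sum>i\<in>UNIV. f i (x0 $ i + (L *v z) $ i))"

definition A_mat ::
  "nat \<Rightarrow> real^'n^'n \<Rightarrow> ('n \<Rightarrow> real \<Rightarrow> real) \<Rightarrow> real^'n \<Rightarrow> real^'n \<Rightarrow> real^'n^'n::finite" where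
  "A_mat q L f x0 z = (\<Sum>p=0..q. matpow (mat 1 - L ** hess f (x0 + L *v z) ** L) p)"

end

theory Submission
  imports Defs
begin

text \<open>
  On \<open>V = {v. vec 1 \<bullet> v = 0}\<close>, which \<open>U\<close> parametrizes isometrically, the bounds on the reduced Hessian
  say that \<open>N = I - L H L\<close> has quadratic form at most \<open>\<epsilon>\<close> in absolute value. Hence
  \<open>A\<^sub>q = \<Sum>p\<le>q. N\<^sup>p\<close> satisfies \<open>v \<bullet> A\<^sub>q v \<ge> (1 - \<epsilon>) |v|\<^sup>2\<close> and \<open>|A\<^sub>q v|\<^sup>2 \<le> a (v \<bullet> A\<^sub>q v)\<close> there, where
  \<open>a = (1 - \<epsilon>\<^sup>q\<^sup>+\<^sup>1) / (1 - \<epsilon>)\<close>. Since the curvature of \<open>g\<close> along \<open>V\<close> is at most \<open>1 + \<epsilon>\<close>, each step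
  decreases \<open>g\<close> by at least a constant times \<open>|\<nabla>g|\<^sup>2\<close> as soon as \<open>\<alpha> (1 + \<epsilon>) a < 2\<close>; the factor \<open>n - 1\<close>
  in the step size bound is slack. The curvature is also at least \<open>1 - \<epsilon>\<close>, so \<open>g\<close> is bounded below
  on \<open>z 0 + V\<close>, the gradients tend to \<open>0\<close>, and strong monotonicity of \<open>\<nabla>g\<close> makes the iterates Cauchy.
\<close>

subsection \<open>Truncated Neumann series of a symmetric operator\<close>

text \<open>All bounds are relative to \<open>V\<close>: the intended \<open>N = I - L H L\<close>
  fixes \<open>vec 1\<close>, so it can contract only on the orthogonal complement of that
  vector.\<close>

locale symmetric_contraction =
  fixes V :: "'a::real_inner set" and N :: "'a \<Rightarrow> 'a" and e :: real
  assumes V: "subspace V"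
    and lin: "linear N"
    and inv: "v \<in> V \<Longrightarrow> N v \<in> V"
    and sym: "u \<in> V \<Longrightarrow> v \<in> V \<Longrightarrow> u \<bullet> N v = N u \<bullet> v"
    and quad: "v \<in> V \<Longrightarrow> \<bar>v \<bullet> N v\<bar> \<le> e * (v \<bullet> v)"
    and e: "0 \<le> e" "e < 1"
begin

text \<open>Polarization bounds \<open>u \<bullet> N v\<close>; then take \<open>u = N v / e\<close>.\<close>

lemma norm_le:
  assumes "v \<in> V"
  shows "norm (N v) \<le> e * norm v"
proof -
  have pol: "2 * (u \<bullet> N v) \<le> e * (u \<bullet> u + v \<bullet> v)" if "u \<in> V" for u
  proof -
    have "(u + v) \<bullet> N (u + v) \<le> e * ((u + v) \<bullet> (u + v))"
         "- ((u - v) \<bullet> N (u - v)) \<le> e * ((u - v) \<bullet> (u - v))"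
      using quad[of "u + v"] quad[of "u - v"] that assms V by (auto simp: subspace_add subspace_diff)
    moreover have "v \<bullet> N u = u \<bullet> N v"
      using sym[OF that assms] by (simp add: inner_commute[of v])
    then have "(u + v) \<bullet> N (u + v) = u \<bullet> N u + 2 * (u \<bullet> N v) + v \<bullet> N v"
      and "(u - v) \<bullet> N (u - v) = u \<bullet> N u - 2 * (u \<bullet> N v) + v \<bullet> N v"
      by (simp_all add: linear_add[OF lin] linear_diff[OF lin] inner_add_left inner_add_right
          inner_diff_left inner_diff_right)
    moreover have "(u + v) \<bullet> (u + v) + (u - v) \<bullet> (u - v) = 2 * (u \<bullet> u + v \<bullet> v)"
      by (simp add: inner_add_left inner_add_right inner_diff_left inner_diff_right)
    then have "e * ((u + v) \<bullet> (u + v)) + e * ((u - v) \<bullet> (u - v)) = 2 * (e * (u \<bullet> u + v \<bullet> v))"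
      by (metis distrib_left mult.left_commute)
    ultimately show ?thesis by linarith
  qed
  \<comment> \<open>The choice \<open>u = N v / e\<close> in \<open>pol\<close> requires
    \<open>e\<close> nonzero; for \<open>e = 0\<close> the choice \<open>u = N v\<close> already
    forces \<open>N v = 0\<close>.\<close>
  have "N v \<bullet> N v \<le> e\<^sup>2 * (v \<bullet> v)"
  proof (cases "e = 0")
    case True
    then show ?thesis using pol[OF inv[OF assms]] by simp
  next
    case False
    then have "0 < e" using e by simp
    have "2 * ((1 / e) * (N v \<bullet> N v)) \<le> e * ((1 / e)\<^sup>2 * (N v \<bullet> N v) + v \<bullet> v)"
      using pol[of "(1 / e) *\<^sub>R N v"] inv[OF assms] V
      by (simp add: subspace_scale power2_eq_square mult.assoc)
    also have "\<dots> = (1 / e) * (N v \<bullet> N v) + e * (v \<bullet> v)"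
      using \<open>0 < e\<close> by (simp add: power2_eq_square distrib_left)
    finally have "(1 / e) * (N v \<bullet> N v) \<le> e * (v \<bullet> v)" by linarith
    then show ?thesis
      using \<open>0 < e\<close> by (simp add: pos_divide_le_eq power2_eq_square mult_ac)
  qed
  then have "(norm (N v))\<^sup>2 \<le> (e * norm v)\<^sup>2"
    by (simp add: power2_norm_eq_inner power_mult_distrib)
  then show ?thesis
    by (rule power2_le_imp_le) (use e in simp)
qed

lemma pow_in: "v \<in> V \<Longrightarrow> (N ^^ p) v \<in> V"
  by (induction p) (auto simp: inv)

lemma pow_norm_le: "v \<in> V \<Longrightarrow> norm ((N ^^ p) v) \<le> e ^ p * norm v"
proof (induction p)
  case (Suc p)
  have "norm (N ((N ^^ p) v)) \<le> e * norm ((N ^^ p) v)"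
    using Suc by (intro norm_le pow_in)
  also have "\<dots> \<le> e * (e ^ p * norm v)"
    using Suc e by (intro mult_left_mono) auto
  finally show ?case by simp
qed simp

lemma pow_sym: "u \<in> V \<Longrightarrow> v \<in> V \<Longrightarrow> u \<bullet> (N ^^ p) v = (N ^^ p) u \<bullet> v"
proof (induction p arbitrary: u)
  case (Suc p)
  have "u \<bullet> N ((N ^^ p) v) = (N ^^ p) (N u) \<bullet> v"
    using Suc by (simp add: sym pow_in inv)
  then show ?case by (simp add: funpow_swap1)
qed simp

text \<open>Truncated Neumann series for the inverse of \<open>I - N\<close>. With
  \<open>N = I - L H L\<close> it is the action of \<open>A_mat q\<close> on a vector.\<close>

definition series :: "nat \<Rightarrow> 'a \<Rightarrow> 'a" where
  "series q v = (\<Sum>p=0..q. (N ^^ p) v)"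

lemma linear_series: "linear (series q)"
proof -
  have "linear (N ^^ p)" for p
    by (induction p) (simp_all only: funpow.simps linear_id linear_compose[OF _ lin])
  then show ?thesis
    unfolding series_def by (intro linear_compose_sum) auto
qed

lemma series_in: "v \<in> V \<Longrightarrow> series q v \<in> V"
  unfolding series_def by (intro subspace_sum[OF V] pow_in)

lemma series_sym: "u \<in> V \<Longrightarrow> v \<in> V \<Longrightarrow> u \<bullet> series q v = series q u \<bullet> v"
  unfolding series_def by (simp add: inner_sum_left inner_sum_right pow_sym)

lemma series_norm_le:
  assumes "v \<in> V"
  shows "norm (series q v) \<le> (\<Sum>p=0..q. e ^ p) * norm v"
  unfolding series_def sum_distrib_right
  using pow_norm_le[OF assms] by (intro sum_norm_le) auto

text \<open>Peeling off two terms at once keeps odd powers of \<open>N\<close>, which need not be positive, paired as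
  \<open>I + N\<close> in the induction for \<open>series_coercive\<close>.\<close>

lemma series_Suc_Suc: "series (Suc (Suc q)) v = v + N v + N (series q (N v))"
proof -
  have "series (Suc (Suc q)) v = v + N v + (\<Sum>p=0..q. (N ^^ Suc (Suc p)) v)"
    unfolding series_def
    by (simp add: sum.atLeast0_atMost_Suc_shift o_def add.assoc del: sum.cl_ivl_Suc)
  also have "(\<Sum>p=0..q. (N ^^ Suc (Suc p)) v) = N (series q (N v))"
    unfolding series_def by (simp add: linear_sum[OF lin] funpow_swap1)
  finally show ?thesis .
qed

text \<open>The constant does not depend on \<open>q\<close>: in the step \<open>v + N v\<close>
  alone contributes \<open>1 - e\<close>, and by symmetry of \<open>N\<close> the remaining term is
  the form of the shorter series at \<open>N v\<close>, which is nonnegative by induction.\<close>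

lemma series_coercive: "v \<in> V \<Longrightarrow> (1 - e) * (v \<bullet> v) \<le> v \<bullet> series q v"
proof (induction q arbitrary: v rule: induct_nat_012)
  case 0
  have "0 \<le> e * (v \<bullet> v)" using e by simp
  then show ?case by (simp add: series_def algebra_simps)
next
  case 1
  show ?case using quad[OF 1] by (simp add: series_def algebra_simps)
next
  case (ge2 n)
  have "0 \<le> (1 - e) * (N v \<bullet> N v)" using e by simp
  also have "\<dots> \<le> N v \<bullet> series n (N v)" using ge2 inv by blast
  also have "\<dots> = v \<bullet> N (series n (N v))"
    using ge2 by (intro sym[symmetric] series_in inv) auto
  finally show ?case
    using quad[of v] ge2 by (simp add: series_Suc_Suc algebra_simps)
qed

text \<open>Cauchy--Schwarz for the positive semidefinite form of \<open>series q\<close>, in the guise of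
  nonnegativity at \<open>v - series q v / a\<close>.\<close>

lemma series_norm_sq_le:
  assumes "v \<in> V"
  shows "(norm (series q v))\<^sup>2 \<le> (\<Sum>p=0..q. e ^ p) * (v \<bullet> series q v)"
proof -
  define a where "a = (\<Sum>p=0..q. e ^ p)"
  define u where "u = series q v"
  have "u \<in> V" unfolding u_def by (rule series_in[OF assms])
  have "e ^ 0 \<le> a" unfolding a_def using e by (intro member_le_sum) auto
  then have "0 < a" by simp
  have "u \<bullet> series q u \<le> norm u * norm (series q u)" by (rule norm_cauchy_schwarz)
  also have "\<dots> \<le> norm u * (a * norm u)"
    unfolding a_def using series_norm_le[OF \<open>u \<in> V\<close>] by (intro mult_left_mono) auto
  finally have 1: "u \<bullet> series q u \<le> a * (u \<bullet> u)"
    by (simp add: power2_norm_eq_inner[symmetric] power2_eq_square mult_ac)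
  have "v - (1 / a) *\<^sub>R u \<in> V" (is "?w \<in> V")
    using V assms \<open>u \<in> V\<close> by (simp add: subspace_diff subspace_scale)
  have "0 \<le> (1 - e) * (?w \<bullet> ?w)" using e by simp
  also have "\<dots> \<le> ?w \<bullet> series q ?w" using series_coercive[OF \<open>?w \<in> V\<close>] .
  finally have "0 \<le> ?w \<bullet> series q ?w" .
  also have "?w \<bullet> series q ?w = v \<bullet> u - 2 * (1 / a) * (u \<bullet> u) + (1 / a)\<^sup>2 * (u \<bullet> series q u)"
    using series_sym[OF assms \<open>u \<in> V\<close>, of q]
    by (simp add: linear_diff[OF linear_series] linear_scale[OF linear_series] u_def[symmetric]
        algebra_simps power2_eq_square inner_commute)
  also have "\<dots> \<le> v \<bullet> u - 2 * (1 / a) * (u \<bullet> u) + (1 / a)\<^sup>2 * (a * (u \<bullet> u))"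
    using 1 by (intro add_left_mono mult_left_mono) auto
  also have "\<dots> = v \<bullet> u - (u \<bullet> u) / a"
    using \<open>0 < a\<close> by (simp add: field_simps power2_eq_square)
  finally show ?thesis
    using \<open>0 < a\<close> by (simp add: power2_norm_eq_inner a_def[symmetric] u_def[symmetric] field_simps)
qed

end

subsection \<open>The matrix \<open>U\<close>\<close>

text \<open>In terms of \<open>s = sqrt n\<close>, the upper block of \<open>U\<close> is the
  identity minus the constant matrix \<open>r\<close>, and its last row is constantly
  \<open>- 1 / s\<close>. So \<open>U u = v\<close> can be solved explicitly.\<close>

lemma U_mat_surj_isometric:
  fixes \<nu> :: "'n::finite \<Rightarrow> nat" and \<kappa> :: "'m::finite \<Rightarrow> nat" and v :: "real^'n"
  assumes n: "CARD('n) \<ge> 2"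
    and \<nu>: "bij_betw \<nu> UNIV {1..CARD('n)}" and \<kappa>: "bij_betw \<kappa> UNIV {1..CARD('n) - 1}"
    and v: "(\<Sum>i\<in>UNIV. v $ i) = 0"
  obtains u :: "real^'m" where "U_mat \<nu> \<kappa> *v u = v" "norm u = norm v"
proof -
  define s where "s = sqrt (real CARD('n))"
  have s: "s > 0" "real CARD('n) = s\<^sup>2" unfolding s_def using n by auto
  \<comment> \<open>The radicand \<open>n * (n + 1 + 2 * sqrt n)\<close> is the square of
    \<open>s * (1 + s)\<close>.\<close>
  define r where "r = 1 / (s * (1 + s))"
  have "sqrt (s\<^sup>2 * (s\<^sup>2 + 1 + 2 * s)) = sqrt ((s * (1 + s))\<^sup>2)"
    by (rule arg_cong[of _ _ sqrt]) (simp add: power2_eq_square algebra_simps)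
  also have "\<dots> = s * (1 + s)" using s by simp
  finally have r: "1 / sqrt (real CARD('n) * (real CARD('n) + 1 + 2 * sqrt (real CARD('n)))) = r"
    unfolding r_def s_def[symmetric] s(2) using s(1) by simp
  \<comment> \<open>\<open>h\<close> sends a column index to the node with the same number, which
    identifies \<open>'m\<close> with the nodes other than the last one, \<open>l\<close>.\<close>
  define h where "h j = inv_into UNIV \<nu> (\<kappa> j)" for j
  have \<nu>h: "\<nu> (h j) = \<kappa> j" for j
  proof -
    have "\<kappa> j \<in> {1..CARD('n)}" using \<kappa> by (auto dest!: bij_betw_apply[where a = j])
    then show ?thesis unfolding h_def using \<nu> by (simp add: bij_betw_inv_into_right)
  qed
  obtain l where l: "\<nu> l = CARD('n)"
    using \<nu> n unfolding bij_betw_def by (metis UNIV_I atLeastAtMost_iff imageE le_trans one_le_numeral order_refl)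
  have h: "bij_betw h UNIV (UNIV - {l})"
    unfolding bij_betw_def
  proof
    show "inj h" using \<nu>h \<kappa> by (metis bij_betw_imp_inj_on inj_def)
    show "range h = UNIV - {l}"
    proof (intro subset_antisym subsetI)
      fix i assume "i \<in> range h"
      then obtain j where j: "i = h j" by blast
      have "\<kappa> j \<in> {1..CARD('n) - 1}" using \<kappa> by (auto dest!: bij_betw_apply[where a = j])
      then have "\<nu> i \<noteq> CARD('n)" using n \<nu>h[of j] j by auto
      then show "i \<in> UNIV - {l}" using l by auto
    next
      fix i assume "i \<in> UNIV - {l}"
      then have "\<nu> i \<noteq> CARD('n)" using \<nu> l by (metis DiffD2 UNIV_I bij_betw_imp_inj_on inj_on_def insertI1)
      moreover have "\<nu> i \<in> {1..CARD('n)}" using \<nu> by (auto dest!: bij_betw_apply[where a = i])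
      ultimately have "\<nu> i \<in> {1..CARD('n) - 1}" by auto
      then obtain j where "\<kappa> j = \<nu> i" using \<kappa> unfolding bij_betw_def by (metis imageE)
      then have "h j = i" using \<nu>h[of j] \<nu> by (metis UNIV_I bij_betw_imp_inj_on inj_on_def)
      then show "i \<in> range h" by blast
    qed
  qed
  have hl: "h j \<noteq> l" for j using h by (auto simp: bij_betw_def)
  have split: "(\<Sum>i\<in>UNIV. F i) = F l + (\<Sum>j\<in>UNIV. F (h j))" for F :: "'n \<Rightarrow> real"
    using sum.reindex_bij_betw[OF h, of F] by (simp add: sum.remove[of UNIV l])
  have card_m: "real CARD('m) = s\<^sup>2 - 1"
    using bij_betw_same_card[OF \<kappa>] n s(2) by (simp add: of_nat_diff)
  \<comment> \<open>The row of \<open>U\<close> with number \<open>n\<close> gives \<open>(U u) $ l = - S / s\<close> for \<open>S\<close> the sum of the entries of \<open>u\<close>.\<close>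
  define S where "S = - s * v $ l"
  define u :: "real^'m" where "u = (\<chi> j. v $ h j + r * S)"
  have vl: "v $ l = - S / s" unfolding S_def using s by simp
  have sv: "(\<Sum>j\<in>UNIV. v $ h j) = S / s" using v split[of "\<lambda>i. v $ i"] vl by simp
  have rs: "(s\<^sup>2 - 1) * r = 1 - 1 / s"
    unfolding r_def using s by (simp add: divide_simps) (simp add: power2_eq_square algebra_simps)
  \<comment> \<open>Consistency check: \<open>u\<close> was built from a prescribed entry sum
    \<open>S\<close>, and its entries do add up to \<open>S\<close>.\<close>
  have "(\<Sum>j\<in>UNIV. u $ j) = S / s + (s\<^sup>2 - 1) * r * S"
    unfolding u_def by (simp add: sum.distrib sv card_m)
  then have su: "(\<Sum>j\<in>UNIV. u $ j) = S" unfolding rs by (simp add: algebra_simps)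
  have Ul: "U_mat \<nu> \<kappa> $ l $ j = - r * (1 + s)" for j
    unfolding U_mat_def Let_def r using l by (simp add: s_def)
  have Uh: "U_mat \<nu> \<kappa> $ h i $ j = (if i = j then 1 else 0) - r" for i j
  proof -
    have "\<kappa> i \<noteq> CARD('n)" using hl[of i] \<nu>h[of i] l \<nu> by (metis UNIV_I bij_betw_imp_inj_on inj_on_def)
    moreover have "\<kappa> i = \<kappa> j \<longleftrightarrow> i = j" using \<kappa> by (metis UNIV_I bij_betw_imp_inj_on inj_on_def)
    moreover have "r * (s\<^sup>2 - 1 + s) = 1 - r"
      unfolding r_def using s by (simp add: divide_simps) (simp add: power2_eq_square algebra_simps)
    ultimately show ?thesis
      unfolding U_mat_def Let_def r using \<nu>h s(1) by (simp add: s_def[symmetric] s(2))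
  qed
  have "(U_mat \<nu> \<kappa> *v u) $ i = v $ i" for i
  proof (cases "i = l")
    case True
    have "(U_mat \<nu> \<kappa> *v u) $ l = - r * (1 + s) * S"
      by (simp add: matrix_vector_mult_def Ul sum_negf sum_distrib_left[symmetric] su)
    also have "\<dots> = v $ l" unfolding vl r_def using s by (simp add: divide_simps)
    finally show ?thesis using True by simp
  next
    case False
    then obtain j where j: "i = h j" using h by (auto simp: bij_betw_def)
    have "(U_mat \<nu> \<kappa> *v u) $ h j = u $ j - r * S"
      by (simp add: matrix_vector_mult_def Uh left_diff_distrib sum_subtractf
          sum_distrib_left[symmetric] su if_distrib[of "\<lambda>x. x * _"] cong: if_cong)
    then show ?thesis unfolding j by (simp add: u_def)
  qed
  then have Uu: "U_mat \<nu> \<kappa> *v u = v" by (simp add: vec_eq_iff)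
  \<comment> \<open>The shift of every entry by \<open>r * S\<close> contributes
    \<open>r * (1 + 1 / s) * S\<^sup>2 = (S / s)\<^sup>2\<close>, exactly the missing square of
    \<open>v $ l\<close>.\<close>
  have "u \<bullet> u = (\<Sum>j\<in>UNIV. (v $ h j)\<^sup>2 + 2 * r * S * v $ h j + (r * S)\<^sup>2)"
    unfolding inner_vec_def by (rule sum.cong) (auto simp: u_def power2_eq_square algebra_simps)
  also have "\<dots> = (\<Sum>j\<in>UNIV. (v $ h j)\<^sup>2) + 2 * r * S * (S / s) + (s\<^sup>2 - 1) * r * (r * S\<^sup>2)"
    by (simp add: sum.distrib sum_distrib_left[symmetric] sv card_m power2_eq_square)
  also have "2 * r * S * (S / s) + (s\<^sup>2 - 1) * r * (r * S\<^sup>2) = r * (1 + 1 / s) * S\<^sup>2"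
    unfolding rs by (simp add: power2_eq_square algebra_simps)
  then have "(\<Sum>j\<in>UNIV. (v $ h j)\<^sup>2) + 2 * r * S * (S / s) + (s\<^sup>2 - 1) * r * (r * S\<^sup>2)
      = (\<Sum>j\<in>UNIV. (v $ h j)\<^sup>2) + r * (1 + 1 / s) * S\<^sup>2" by simp
  also have "r * (1 + 1 / s) * S\<^sup>2 = (v $ l)\<^sup>2"
    unfolding vl r_def using s by (simp add: divide_simps) (simp add: power2_eq_square algebra_simps)
  also have "(\<Sum>j\<in>UNIV. (v $ h j)\<^sup>2) + (v $ l)\<^sup>2 = v \<bullet> v"
    unfolding inner_vec_def using split[of "\<lambda>i. (v $ i)\<^sup>2"] by (simp add: power2_eq_square)
  finally have "norm u = norm v" by (simp add: norm_eq_sqrt_inner)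
  with Uu show ?thesis by (rule that)
qed

subsection \<open>Descent for functions strongly convex along a subspace\<close>

text \<open>\<open>G\<close> stands for the gradient but is tied to \<open>g\<close> only by the two
  inequalities. The limit comes from completeness, so no minimizer has to be known in
  advance.\<close>

lemma descent_convergent:
  fixes z :: "nat \<Rightarrow> 'a::euclidean_space"
  assumes V: "subspace V" and G: "continuous_on UNIV G" and pos: "0 < c" "0 < \<mu>"
    and step: "\<And>k. z (Suc k) - z k \<in> V"
    and descent: "\<And>k. g (z (Suc k)) \<le> g (z k) - c * (norm (G (z k)))\<^sup>2"
    and convex: "\<And>x y. y - x \<in> V \<Longrightarrow> g x + G x \<bullet> (y - x) + \<mu> / 2 * (norm (y - x))\<^sup>2 \<le> g y"
  obtains zs where "z \<longlonglongrightarrow> zs" "G zs = 0" "zs - z 0 \<in> V"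
proof -
  have z0: "z k - z 0 \<in> V" for k
  proof (induction k)
    case (Suc k)
    then show ?case using subspace_add[OF V step[of k] Suc] by simp
  qed (simp add: subspace_0[OF V])
  then have zV: "z k - z l \<in> V" for k l
    using subspace_diff[OF V z0[of k] z0[of l]] by simp
  \<comment> \<open>Completing the square: \<open>- a * b + \<mu> / 2 * b\<^sup>2\<close> is at
    least \<open>- a\<^sup>2 / (2 * \<mu>)\<close>.\<close>
  have lower: "g (z 0) - (norm (G (z 0)))\<^sup>2 / (2 * \<mu>) \<le> g (z k)" for k
  proof -
    let ?a = "norm (G (z 0))" and ?b = "norm (z k - z 0)"
    have "- (?a * ?b) \<le> G (z 0) \<bullet> (z k - z 0)"
      using Cauchy_Schwarz_ineq2[of "G (z 0)" "z k - z 0"] by linarith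
    moreover have "0 \<le> (?a - \<mu> * ?b)\<^sup>2 / (2 * \<mu>)" using pos by simp
    then have "0 \<le> ?a\<^sup>2 / (2 * \<mu>) - ?a * ?b + \<mu> / 2 * ?b\<^sup>2"
      using pos by (simp add: power2_diff power_mult_distrib field_simps) (simp add: power2_eq_square)
    ultimately show ?thesis using convex[OF z0[of k]] by linarith
  qed
  have dec: "g (z (Suc k)) \<le> g (z k)" for k
    using descent[of k] pos by (smt (verit) mult_nonneg_nonneg zero_le_power2)
  obtain l where l: "(\<lambda>k. g (z k)) \<longlonglongrightarrow> l"
    using decseq_convergent[of "\<lambda>k. g (z k)"] decseq_SucI[of "\<lambda>k. g (z k)"] dec lower by metis
  have "(\<lambda>k. (g (z k) - g (z (Suc k))) / c) \<longlonglongrightarrow> (l - l) / c"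
    using pos by (intro tendsto_intros l LIMSEQ_Suc[OF l]) auto
  then have "(\<lambda>k. (g (z k) - g (z (Suc k))) / c) \<longlonglongrightarrow> 0" by simp
  moreover have "norm ((norm (G (z k)))\<^sup>2) \<le> (g (z k) - g (z (Suc k))) / c" for k
    using descent[of k] pos by (simp add: field_simps)
  ultimately have "(\<lambda>k. (norm (G (z k)))\<^sup>2) \<longlonglongrightarrow> 0"
    using Lim_null_comparison[OF always_eventually] by fast
  then have "(\<lambda>k. sqrt ((norm (G (z k)))\<^sup>2)) \<longlonglongrightarrow> sqrt 0"
    by (intro tendsto_intros)
  then have G0: "(\<lambda>k. norm (G (z k))) \<longlonglongrightarrow> 0" by simp
  \<comment> \<open>Adding \<open>convex\<close> for both orders of the two points cancels the
    values of \<open>g\<close>. The resulting bound controls distances between iterates by gradients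
    that tend to 0.\<close>
  have mono: "\<mu> * norm (x - y) \<le> norm (G x) + norm (G y)" if "x - y \<in> V" for x y
  proof (cases "x = y")
    case False
    have "y - x \<in> V" using subspace_neg[OF V that] by simp
    have "\<mu> * (norm (x - y))\<^sup>2 \<le> (G x - G y) \<bullet> (x - y)"
      using convex[OF that] convex[OF \<open>y - x \<in> V\<close>]
      by (simp add: norm_minus_commute[of y] inner_diff_left inner_diff_right)
    also have "\<dots> \<le> norm (G x - G y) * norm (x - y)" by (rule norm_cauchy_schwarz)
    finally have "\<mu> * norm (x - y) \<le> norm (G x - G y)"
      using False by (simp add: power2_eq_square)
    then show ?thesis using norm_triangle_ineq4[of "G x" "G y"] by linarith
  qed simp
  have "Cauchy z"
  proof (rule metric_CauchyI)
    fix e :: real assume "0 < e"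
    then have "0 < \<mu> * e / 2" using pos by simp
    then have "\<forall>\<^sub>F k in sequentially. norm (G (z k)) < \<mu> * e / 2"
      by (rule order_tendstoD(2)[OF G0])
    then obtain K where K: "\<And>k. k \<ge> K \<Longrightarrow> norm (G (z k)) < \<mu> * e / 2"
      by (auto simp: eventually_sequentially)
    have "dist (z m) (z n) < e" if "m \<ge> K" "n \<ge> K" for m n
    proof -
      have "\<mu> * norm (z m - z n) < \<mu> * e"
        using mono[OF zV, of m n] K[OF that(1)] K[OF that(2)] by linarith
      then show ?thesis using pos by (simp add: dist_norm)
    qed
    then show "\<exists>M. \<forall>m\<ge>M. \<forall>n\<ge>M. dist (z m) (z n) < e" by blast
  qed
  then obtain zs where zs: "z \<longlonglongrightarrow> zs" using Cauchy_convergent convergent_def by blast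
  have "(\<lambda>k. norm (G (z k))) \<longlonglongrightarrow> norm (G zs)"
    using G zs by (intro tendsto_norm) (auto intro: continuous_on_tendsto_compose)
  then have "G zs = 0" using LIMSEQ_unique[OF G0] by force
  moreover have "zs - z 0 \<in> V"
    by (rule closed_sequentially[OF closed_subspace[OF V] z0 tendsto_diff[OF zs tendsto_const]])
  ultimately show ?thesis using zs that by blast
qed

subsection \<open>The objective function\<close>

lemma inner_matrix_vector_sym:
  fixes L :: "real^'n^'n"
  assumes "transpose L = L"
  shows "u \<bullet> (L *v v) = (L *v u) \<bullet> v"
  by (metis assms dot_lmul_matrix transpose_matrix_vector)

lemma transpose_laplacian:
  assumes "weighted_graph E w"
  shows "transpose (laplacian E w) = laplacian E w"
  using assms unfolding weighted_graph_def laplacian_def transpose_def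
  by (auto simp: vec_eq_iff symp_def)

lemma laplacian_vec_1:
  assumes "weighted_graph E w"
  shows "laplacian E w *v vec 1 = 0"
proof -
  have "(\<Sum>j\<in>UNIV. laplacian E w $ i $ j) = 0" for i
  proof -
    have irr: "\<not> E i i" using assms by (auto simp: weighted_graph_def irreflp_def)
    have "(\<Sum>j\<in>UNIV. laplacian E w $ i $ j)
        = laplacian E w $ i $ i + (\<Sum>j\<in>UNIV - {i}. laplacian E w $ i $ j)"
      by (simp add: sum.remove[of UNIV i])
    also have "(\<Sum>j\<in>UNIV - {i}. laplacian E w $ i $ j)
        = (\<Sum>j\<in>UNIV - {i}. if E i j then - w i j else 0)"
      by (rule sum.cong) (auto simp: laplacian_def)
    also have "\<dots> = (\<Sum>j | E i j. - w i j)"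
      using irr by (subst sum.inter_filter[symmetric]) (auto intro!: sum.cong)
    finally show ?thesis by (simp add: laplacian_def sum_negf)
  qed
  then show ?thesis by (simp add: vec_eq_iff matrix_vector_mult_def)
qed

text \<open>This keeps gradients in \<open>V\<close>, and is the source of the conservation of
  \<open>vec 1 \<bullet> z k\<close>.\<close>

lemma inner_vec_1_laplacian:
  assumes "weighted_graph E w"
  shows "vec 1 \<bullet> (laplacian E w *v v) = 0"
  unfolding inner_matrix_vector_sym[OF transpose_laplacian[OF assms]] laplacian_vec_1[OF assms]
  by (rule inner_zero_left)

section \<open>Gradient and second-order expansion of the objective\<close>

lemma twice_cont_diffD:
  assumes "twice_cont_diff f"
  shows "(f has_real_derivative deriv f s) (at s)"
    and "(deriv f has_real_derivative deriv (deriv f) s) (at s)"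
  using assms unfolding twice_cont_diff_def differentiable_on_def
  by (auto intro: DERIV_deriv_iff_real_differentiable[THEN iffD2])

text \<open>The gradient of the separable function whose Hessian is \<open>hess f\<close>.\<close>

definition partials :: "('n \<Rightarrow> real \<Rightarrow> real) \<Rightarrow> real^'n \<Rightarrow> real^'n" where
  "partials f x = (\<chi> i. deriv (f i) (x $ i))"

lemma gradient_objective:
  assumes "transpose L = L" and f: "\<And>i. twice_cont_diff (f i)"
  shows "gradient (objective L f x0) z = L *v partials f (x0 + L *v z)"
proof -
  let ?D = "L *v partials f (x0 + L *v z)"
  have "((\<lambda>z. f i (x0 $ i + (L *v z) $ i)) has_derivative
      (\<lambda>h. deriv (f i) (x0 $ i + (L *v z) $ i) * (L *v h) $ i)) (at z)" for i
  proof -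
    have "((\<lambda>z. x0 $ i + (L *v z) $ i) has_derivative (\<lambda>h. 0 + (L *v h) $ i)) (at z)"
      by (intro has_derivative_add has_derivative_const bounded_linear.has_derivative[OF bounded_linear_vec_nth]
          bounded_linear_imp_has_derivative matrix_vector_mul_bounded_linear)
    then show ?thesis
      using has_derivative_compose twice_cont_diffD(1)[OF f, unfolded has_field_derivative_def]
      by fastforce
  qed
  then have "(objective L f x0 has_derivative
      (\<lambda>h. \<Sum>i\<in>UNIV. deriv (f i) (x0 $ i + (L *v z) $ i) * (L *v h) $ i)) (at z)"
    unfolding objective_def by (intro has_derivative_sum)
  also have "(\<lambda>h. \<Sum>i\<in>UNIV. deriv (f i) (x0 $ i + (L *v z) $ i) * (L *v h) $ i) = (\<lambda>h. h \<bullet> ?D)"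
    by (simp add: inner_matrix_vector_sym[OF assms(1)])
       (simp add: inner_vec_def partials_def mult.commute)
  finally have D: "GDERIV (objective L f x0) z :> ?D" unfolding gderiv_def .
  \<comment> \<open>\<open>gradient\<close> is a definite description, so uniqueness of the
    derivative is needed as well.\<close>
  show ?thesis
    unfolding gradient_def
  proof (rule the_equality[of "\<lambda>D. GDERIV (objective L f x0) z :> D", OF D])
    fix D' assume "GDERIV (objective L f x0) z :> D'"
    then have "(\<lambda>h. h \<bullet> D') = (\<lambda>h. h \<bullet> ?D)"
      using D unfolding gderiv_def by (rule has_derivative_unique)
    then show "D' = ?D" by (metis vector_eq_ldot)
  qed
qed

lemma inner_hess:
  assumes "transpose L = L"
  shows "v \<bullet> ((L ** hess f x ** L) *v v) = (\<Sum>i\<in>UNIV. deriv (deriv (f i)) (x $ i) * ((L *v v) $ i)\<^sup>2)"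
proof -
  have "v \<bullet> ((L ** hess f x ** L) *v v) = (L *v v) \<bullet> (hess f x *v (L *v v))"
    by (simp add: matrix_vector_mul_assoc[symmetric] inner_matrix_vector_sym[OF assms])
  moreover have "(hess f x *v u) $ i = deriv (deriv (f i)) (x $ i) * u $ i" for u i
    by (simp add: matrix_vector_mult_def hess_def if_distrib[of "\<lambda>x. x * _"] cong: if_cong)
  ultimately show ?thesis by (simp add: inner_vec_def power2_eq_square mult_ac)
qed

text \<open>One-dimensional Taylor formula with Lagrange remainder along the segment from
  \<open>z\<close> to \<open>z + v\<close>. Mere existence of \<open>x\<close> suffices because the
  Hessian bounds hold at every point.\<close>

lemma objective_taylor:
  assumes L: "transpose L = L" and f: "\<And>i. twice_cont_diff (f i)"
  obtains x where "objective L f x0 (z + v) = objective L f x0 z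
      + (L *v partials f (x0 + L *v z)) \<bullet> v + v \<bullet> ((L ** hess f x ** L) *v v) / 2"
proof -
  define y where "y t = x0 + L *v z + t *\<^sub>R (L *v v)" for t
  define D where "D m t = (if m = 0 then \<Sum>i\<in>UNIV. f i (y t $ i)
      else if m = 1 then \<Sum>i\<in>UNIV. deriv (f i) (y t $ i) * (L *v v) $ i
      else \<Sum>i\<in>UNIV. deriv (deriv (f i)) (y t $ i) * (L *v v) $ i * (L *v v) $ i)"
    for m :: nat and t
  have y: "((\<lambda>t. y t $ i) has_real_derivative (L *v v) $ i) (at t)" for t i
    unfolding y_def by (auto intro!: derivative_eq_intros)
  have "(D m has_real_derivative D (Suc m) t) (at t)" if "m < 2" for m t
  proof -
    have "((\<lambda>t. f i (y t $ i)) has_real_derivative deriv (f i) (y t $ i) * (L *v v) $ i) (at t)"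
         "((\<lambda>t. deriv (f i) (y t $ i)) has_real_derivative
            deriv (deriv (f i)) (y t $ i) * (L *v v) $ i) (at t)" for i
      using DERIV_chain2[OF twice_cont_diffD(1)[OF f] y] DERIV_chain2[OF twice_cont_diffD(2)[OF f] y]
      by auto
    moreover have "m = 0 \<or> m = 1" using that by auto
    ultimately show ?thesis
      unfolding D_def by (auto intro!: DERIV_sum DERIV_cmult_right)
  qed
  then obtain t where t: "D 0 1 = (\<Sum>m<2. D m 0 / fact m * (1 - 0) ^ m) + D 2 t / fact 2 * (1 - 0)\<^sup>2"
    using Taylor_up[of 2 D "D 0" 0 1 0] by auto
  have 0: "D 0 1 = objective L f x0 (z + v)" "D 0 0 = objective L f x0 z"
    by (simp_all add: D_def y_def objective_def matrix_vector_right_distrib add.assoc)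
  have 1: "D 1 0 = (L *v partials f (x0 + L *v z)) \<bullet> v"
    unfolding inner_matrix_vector_sym[OF L, symmetric]
    by (simp add: D_def y_def inner_vec_def partials_def)
  have 2: "D 2 t = v \<bullet> ((L ** hess f (y t) ** L) *v v)"
    by (simp add: D_def inner_hess[OF L] power2_eq_square mult.assoc)
  show ?thesis
    by (rule that[of "y t"]) (use t 0 1 2 in \<open>simp add: numeral_2_eq_2\<close>)
qed

section \<open>Matrix polynomials and the reduced Hessian as operators\<close>

lemma matpow_mult_vec: "matpow A p *v v = (((*v) A) ^^ p) v"
  by (induction p) (simp_all add: matpow_def matrix_vector_mul_assoc[symmetric])

lemma A_mat_mult_vec:
  fixes L :: "real^'n^'n"
  shows "A_mat q L f x0 z *v v =
     (\<Sum>p=0..q. ((\<lambda>v. v - (L ** hess f (x0 + L *v z) ** L) *v v) ^^ p) v)"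
proof -
  have "(\<Sum>p=0..q. F p) *v v = (\<Sum>p=0..q. F p *v v)" for F :: "nat \<Rightarrow> real^'n^'n"
    by (induction q) (simp_all add: matrix_vector_mult_add_rdistrib)
  moreover have "(*v) (mat 1 - B) = (\<lambda>v. v - B *v v)" for B :: "real^'n^'n"
    by (simp add: fun_eq_iff matrix_vector_mult_diff_rdistrib)
  ultimately show ?thesis unfolding A_mat_def by (simp add: matpow_mult_vec)
qed

text \<open>Write \<open>v = U u\<close> with \<open>u\<close> of the same norm; the reduced Hessian
  at \<open>u\<close> then has the same quadratic form as \<open>L H L\<close> at \<open>v\<close>,
  so the Loewner bounds transfer.\<close>

lemma reduced_hess_bound:
  fixes \<nu> :: "'n::finite \<Rightarrow> nat" and \<kappa> :: "'m::finite \<Rightarrow> nat"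
  assumes "CARD('n) \<ge> 2"
    and "bij_betw \<nu> UNIV {1..CARD('n)}" and "bij_betw \<kappa> UNIV {1..CARD('n) - 1}"
    and lo: "- (\<epsilon> *\<^sub>R mat 1) \<preceq> mat 1 - reduced_hess \<nu> \<kappa> L f x"
    and hi: "mat 1 - reduced_hess \<nu> \<kappa> L f x \<preceq> \<epsilon> *\<^sub>R mat 1"
    and v: "vec 1 \<bullet> v = 0"
  shows "\<bar>v \<bullet> v - v \<bullet> ((L ** hess f x ** L) *v v)\<bar> \<le> \<epsilon> * (v \<bullet> v)"
proof -
  have "(\<Sum>i\<in>UNIV. v $ i) = 0" using v by (simp add: inner_vec_def)
  then obtain u :: "real^'m" where u: "U_mat \<nu> \<kappa> *v u = v" "norm u = norm v"
    using U_mat_surj_isometric[OF assms(1-3)] by blast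
  have "u \<bullet> (reduced_hess \<nu> \<kappa> L f x *v u) = (U_mat \<nu> \<kappa> *v u) \<bullet> ((L ** hess f x ** L) *v (U_mat \<nu> \<kappa> *v u))"
    unfolding reduced_hess_def
    by (simp add: matrix_vector_mul_assoc[symmetric] inner_commute[of u] dot_lmul_matrix)
       (simp add: inner_commute)
  then have "u \<bullet> (reduced_hess \<nu> \<kappa> L f x *v u) = v \<bullet> ((L ** hess f x ** L) *v v)" by (simp add: u)
  moreover have "u \<bullet> u = v \<bullet> v" using u(2) by (simp add: norm_eq_sqrt_inner)
  moreover have "0 \<le> u \<bullet> ((mat 1 - reduced_hess \<nu> \<kappa> L f x - - (\<epsilon> *\<^sub>R mat 1)) *v u)"
    and "0 \<le> u \<bullet> ((\<epsilon> *\<^sub>R mat 1 - (mat 1 - reduced_hess \<nu> \<kappa> L f x)) *v u)"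
    using lo hi unfolding loewner_le_def psd_def by blast+
  ultimately show ?thesis
    by (simp add: matrix_vector_mult_diff_rdistrib matrix_vector_mult_add_rdistrib
        scaleR_matrix_vector_assoc[symmetric] inner_diff_right inner_add_right abs_le_iff)
qed

section \<open>Convergence of the iteration\<close>

theorem theorem1:
  fixes \<nu> :: "'n::finite \<Rightarrow> nat" and \<kappa> :: "'m::finite \<Rightarrow> nat"
    and E :: "'n \<Rightarrow> 'n \<Rightarrow> bool" and w :: "'n \<Rightarrow> 'n \<Rightarrow> real" and L :: "real^'n^'n"
    and d :: real and x0 :: "real^'n"
    and f :: "'n \<Rightarrow> real \<Rightarrow> real" and \<delta> \<Delta> :: "'n \<Rightarrow> real"
    and \<epsilon> \<alpha> :: real and q :: nat and g :: "real^'n \<Rightarrow> real" and z :: "nat \<Rightarrow> real^'n"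
  assumes "CARD('n) \<ge> 2"
    and "bij_betw \<nu> UNIV {1..CARD('n)}" and "bij_betw \<kappa> UNIV {1..CARD('n) - 1}"
    and "weighted_graph E w" and "connected_graph E" and "L = laplacian E w"
    and "(\<Sum>i\<in>UNIV. x0 $ i) = d"
    and "\<And>i. twice_cont_diff (f i)" and "\<And>i. strongly_convex (f i)"
    and "\<And>i. 0 < \<delta> i" and "\<And>i. 0 < \<Delta> i"
    and "\<And>i s. \<delta> i \<le> deriv (deriv (f i)) s \<and> deriv (deriv (f i)) s \<le> \<Delta> i"
    and "\<epsilon> < 1"
    and "\<And>x. - (\<epsilon> *\<^sub>R mat 1) \<preceq> mat 1 - reduced_hess \<nu> \<kappa> L f x"
    and "\<And>x. mat 1 - reduced_hess \<nu> \<kappa> L f x \<preceq> \<epsilon> *\<^sub>R mat 1"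
    and "g = objective L f x0"
    and "0 < \<alpha>"
    and "\<alpha> < 2 * (1 - \<epsilon>) / ((real CARD('n) - 1) * (1 + \<epsilon>) * (1 - \<epsilon> ^ (q + 1)))"
    and "\<And>k. z (Suc k) = z k - \<alpha> *\<^sub>R (A_mat q L f x0 (z k) *v gradient g (z k))"
  shows "\<exists>zs. is_arg_min g (\<lambda>_. True) zs \<and> vec 1 \<bullet> zs = vec 1 \<bullet> z 0 \<and>
           (\<forall>y. is_arg_min g (\<lambda>_. True) y \<and> vec 1 \<bullet> y = vec 1 \<bullet> z 0 \<longrightarrow> y = zs) \<and>
           z \<longlonglongrightarrow> zs"
proof -
  define V :: "(real^'n) set" where "V = {v. vec 1 \<bullet> v = 0}"
  have V: "subspace V" unfolding V_def by (rule subspace_hyperplane)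
  have L: "transpose L = L" using transpose_laplacian assms(4,6) by blast
  have LV: "L *v v \<in> V" for v
    unfolding V_def assms(6) using inner_vec_1_laplacian[OF assms(4)] by blast
  define B where "B x = L ** hess f x ** L" for x
  define G where "G y = L *v partials f (x0 + L *v y)" for y
  have grad: "gradient g y = G y" for y
    unfolding G_def assms(16) by (rule gradient_objective[OF L assms(8)])
  have quad: "\<bar>v \<bullet> v - v \<bullet> (B x *v v)\<bar> \<le> \<epsilon> * (v \<bullet> v)" if "v \<in> V" for v x
    using reduced_hess_bound[OF assms(1-3,14,15)] that unfolding B_def V_def by blast
  \<comment> \<open>Adding the two Loewner bounds at a nonzero vector cancels the reduced Hessian
    and leaves \<open>2 * \<epsilon> * (u \<bullet> u)\<close>.\<close>
  have "0 \<le> \<epsilon>"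
  proof -
    obtain u :: "real^'m" where u: "0 < u \<bullet> u"
      by (metis inner_gt_zero_iff axis_eq_0_iff zero_neq_one)
    have "0 \<le> u \<bullet> ((mat 1 - reduced_hess \<nu> \<kappa> L f x0 - - (\<epsilon> *\<^sub>R mat 1)) *v u)"
      and "0 \<le> u \<bullet> ((\<epsilon> *\<^sub>R mat 1 - (mat 1 - reduced_hess \<nu> \<kappa> L f x0)) *v u)"
      using assms(14,15)[of x0] unfolding loewner_le_def psd_def by blast+
    then have "0 \<le> 2 * \<epsilon> * (u \<bullet> u)"
      by (simp add: matrix_vector_mult_diff_rdistrib matrix_vector_mult_add_rdistrib
          scaleR_matrix_vector_assoc[symmetric] inner_diff_right inner_add_right)
    show ?thesis
    proof (rule ccontr)
      assume "\<not> 0 \<le> \<epsilon>"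
      then have "2 * \<epsilon> * (u \<bullet> u) < 0" by (intro mult_neg_pos[OF _ u]) simp
      with \<open>0 \<le> 2 * \<epsilon> * (u \<bullet> u)\<close> show False by linarith
    qed
  qed
  have taylor: "\<exists>x. g y = g y' + G y' \<bullet> (y - y') + (y - y') \<bullet> (B x *v (y - y')) / 2" for y y'
    by (rule objective_taylor[OF L assms(8), where ?x0.0 = x0 and z = y' and v = "y - y'"])
       (auto simp: assms(16) G_def B_def)
  \<comment> \<open>Along \<open>V\<close>, \<open>quad\<close> confines the Taylor remainder to
    curvatures between \<open>1 - \<epsilon>\<close> and \<open>1 + \<epsilon>\<close>.\<close>
  have lower: "g y' + G y' \<bullet> (y - y') + (1 - \<epsilon>) / 2 * (norm (y - y'))\<^sup>2 \<le> g y"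
    and upper: "g y \<le> g y' + G y' \<bullet> (y - y') + (1 + \<epsilon>) / 2 * (norm (y - y'))\<^sup>2"
    if "y - y' \<in> V" for y y'
  proof -
    obtain x where x: "g y = g y' + G y' \<bullet> (y - y') + (y - y') \<bullet> (B x *v (y - y')) / 2"
      using taylor by blast
    have "(1 - \<epsilon>) / 2 * n \<le> b / 2" and "b / 2 \<le> (1 + \<epsilon>) / 2 * n"
      if "\<bar>n - b\<bar> \<le> \<epsilon> * n" for n b :: real
      using that by (auto simp: abs_le_iff algebra_simps)
    note this[OF quad[OF that, of x, folded power2_norm_eq_inner]]
    with x show "g y' + G y' \<bullet> (y - y') + (1 - \<epsilon>) / 2 * (norm (y - y'))\<^sup>2 \<le> g y"
      and "g y \<le> g y' + G y' \<bullet> (y - y') + (1 + \<epsilon>) / 2 * (norm (y - y'))\<^sup>2"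
      by - linarith+
  qed
  \<comment> \<open>Plain convexity holds in all directions, not only along \<open>V\<close>; it
    makes a zero of \<open>G\<close> a minimizer over the whole space.\<close>
  have convex: "g y' + G y' \<bullet> (y - y') \<le> g y" for y y'
  proof -
    obtain x where x: "g y = g y' + G y' \<bullet> (y - y') + (y - y') \<bullet> (B x *v (y - y')) / 2"
      using taylor by blast
    have "0 \<le> deriv (deriv (f i)) s" for i s using assms(10)[of i] assms(12)[of i s] by linarith
    then have "0 \<le> (y - y') \<bullet> (B x *v (y - y'))"
      unfolding B_def inner_hess[OF L] by (intro sum_nonneg mult_nonneg_nonneg) auto
    with x show ?thesis by simp
  qed
  define a where "a = (\<Sum>p=0..q. \<epsilon> ^ p)"
  have "\<epsilon> ^ 0 \<le> a" unfolding a_def using \<open>0 \<le> \<epsilon>\<close> by (intro member_le_sum) auto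
  then have "0 < a" by simp
  \<comment> \<open>The geometric sum cancels \<open>1 - \<epsilon>\<close> in the step size bound;
    \<open>n - 1 \<ge> 1\<close> then gives
    \<open>\<alpha> * (1 + \<epsilon>) * a < 2\<close>.\<close>
  have "1 - \<epsilon> ^ (q + 1) = (1 - \<epsilon>) * a"
    unfolding a_def using one_diff_power_eq[of \<epsilon> "q + 1"]
    by (simp add: atLeast0AtMost lessThan_Suc_atMost)
  then have "2 * (1 - \<epsilon>) / ((real CARD('n) - 1) * (1 + \<epsilon>) * (1 - \<epsilon> ^ (q + 1)))
      = ((1 - \<epsilon>) * 2) / ((1 - \<epsilon>) * ((real CARD('n) - 1) * ((1 + \<epsilon>) * a)))"
    by (simp only: mult_ac)
  also have "\<dots> = 2 / ((real CARD('n) - 1) * ((1 + \<epsilon>) * a))"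
    using assms(13) by (intro mult_divide_mult_cancel_left) simp
  finally have "\<alpha> < 2 / ((real CARD('n) - 1) * ((1 + \<epsilon>) * a))"
    using assms(18) by simp
  also have "\<dots> \<le> 2 / (1 * ((1 + \<epsilon>) * a))"
    using assms(1) \<open>0 < a\<close> \<open>0 \<le> \<epsilon>\<close> by (intro divide_left_mono mult_right_mono mult_pos_pos) auto
  finally have "\<alpha> * ((1 + \<epsilon>) * a) < 2"
    using \<open>0 < a\<close> \<open>0 \<le> \<epsilon>\<close> by (simp add: pos_less_divide_eq)
  then have b: "0 < 1 - \<alpha> * (1 + \<epsilon>) * a / 2" by simp
  \<comment> \<open>The first two factors are what the second-order term leaves of the first-order
    decrease; the last is the coercivity constant of the series.\<close>
  define c where "c = \<alpha> * (1 - \<alpha> * (1 + \<epsilon>) * a / 2) * (1 - \<epsilon>)"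
  have "0 < c" unfolding c_def using b assms(13,17) by simp
  have step: "z (Suc k) - z k \<in> V"
    and descent: "g (z (Suc k)) \<le> g (z k) - c * (norm (G (z k)))\<^sup>2" for k
  proof -
    define N where "N v = v - B (x0 + L *v z k) *v v" for v
    \<comment> \<open>A separate interpretation for each \<open>k\<close>, since the Hessian in
      \<open>N\<close> is taken at the current iterate.\<close>
    interpret symmetric_contraction V N \<epsilon>
    proof (rule symmetric_contraction.intro)
      show "linear N" unfolding N_def by (intro linear_compose_sub linear_ident) simp
      show "N v \<in> V" if "v \<in> V" for v
        unfolding N_def using V that LV by (simp add: B_def subspace_diff matrix_vector_mul_assoc[symmetric])
      have "transpose (hess f x) = hess f x" for x
        by (simp add: transpose_def hess_def vec_eq_iff)
      then have "u \<bullet> (B x *v v) = (B x *v u) \<bullet> v" for u v x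
        unfolding B_def matrix_vector_mul_assoc[symmetric] by (simp only: inner_matrix_vector_sym L)
      then show "u \<bullet> N v = N u \<bullet> v" for u v
        unfolding N_def by (simp add: inner_diff_left inner_diff_right)
      show "\<bar>v \<bullet> N v\<bar> \<le> \<epsilon> * (v \<bullet> v)" if "v \<in> V" for v
        unfolding N_def using quad[OF that] by (simp add: inner_diff_right)
    qed (use V \<open>0 \<le> \<epsilon>\<close> assms(13) in auto)
    let ?G = "G (z k)" and ?s = "series q (G (z k))"
    have "?G \<in> V" unfolding G_def by (rule LV)
    have "A_mat q L f x0 (z k) *v ?G = ?s"
      unfolding series_def A_mat_mult_vec by (simp add: N_def[abs_def] B_def)
    then have z: "z (Suc k) - z k = - (\<alpha> *\<^sub>R ?s)"
      using assms(19)[of k] by (simp add: grad)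
    show V_step: "z (Suc k) - z k \<in> V"
      unfolding z using V series_in[OF \<open>?G \<in> V\<close>] by (intro subspace_neg subspace_scale)
    have "g (z (Suc k)) \<le> g (z k) - \<alpha> * (?G \<bullet> ?s) + \<alpha>\<^sup>2 * (1 + \<epsilon>) / 2 * (norm ?s)\<^sup>2"
      using upper[OF V_step] unfolding z by (simp add: power_mult_distrib mult_ac)
    \<comment> \<open>Bounding the quadratic term by a multiple of \<open>?G \<bullet> ?s\<close>
      lets it be absorbed in the linear one; coercivity enters only afterwards.\<close>
    also have "\<dots> \<le> g (z k) - \<alpha> * (?G \<bullet> ?s) + \<alpha>\<^sup>2 * (1 + \<epsilon>) / 2 * (a * (?G \<bullet> ?s))"
      unfolding a_def using series_norm_sq_le[OF \<open>?G \<in> V\<close>] \<open>0 \<le> \<epsilon>\<close>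
      by (intro add_left_mono mult_left_mono) auto
    also have "\<dots> = g (z k) - \<alpha> * (1 - \<alpha> * (1 + \<epsilon>) * a / 2) * (?G \<bullet> ?s)"
      by (simp add: field_simps power2_eq_square)
    also have "\<dots> \<le> g (z k) - \<alpha> * (1 - \<alpha> * (1 + \<epsilon>) * a / 2) * ((1 - \<epsilon>) * (?G \<bullet> ?G))"
      using series_coercive[OF \<open>?G \<in> V\<close>] b assms(17) by (intro diff_left_mono mult_left_mono) auto
    finally show "g (z (Suc k)) \<le> g (z k) - c * (norm ?G)\<^sup>2"
      unfolding c_def by (simp add: power2_norm_eq_inner mult.assoc)
  qed
  have cont: "continuous_on UNIV (deriv (f i))" for i
    by (intro continuous_at_imp_continuous_on ballI DERIV_isCont[OF twice_cont_diffD(2)[OF assms(8)]])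
  have "continuous_on UNIV (\<lambda>y. x0 $ i + (L *v y) $ i)" for i
    by (intro continuous_intros matrix_vector_mult_linear_continuous_on)
  then have "continuous_on UNIV (\<lambda>y. deriv (f i) (x0 $ i + (L *v y) $ i))" for i
    by (rule continuous_on_compose2[OF cont]) auto
  then have "continuous_on UNIV (\<lambda>y. partials f (x0 + L *v y))"
    unfolding partials_def by (intro continuous_on_vec_lambda) simp
  then have "continuous_on UNIV G"
    unfolding G_def by (rule continuous_on_compose2[OF matrix_vector_mult_linear_continuous_on]) auto
  moreover have "0 < 1 - \<epsilon>" using assms(13) by simp
  ultimately obtain zs where zs: "z \<longlonglongrightarrow> zs" "G zs = 0" "zs - z 0 \<in> V"
    using descent_convergent[where G = G and g = g and z = z and \<mu> = "1 - \<epsilon>",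
        OF V _ \<open>0 < c\<close> _ step descent lower]
    by blast
  have "is_arg_min g (\<lambda>_. True) zs"
    unfolding is_arg_min_def using convex[of zs] zs(2) by (simp add: not_less)
  moreover have sum_zs: "vec 1 \<bullet> zs = vec 1 \<bullet> z 0"
    using zs(3) unfolding V_def by (simp add: inner_diff_right)
  \<comment> \<open>Minimizers with equal entry sums differ by an element of \<open>V\<close>, along
    which \<open>g\<close> grows at least quadratically from \<open>zs\<close>.\<close>
  moreover have "y = zs" if y: "is_arg_min g (\<lambda>_. True) y" "vec 1 \<bullet> y = vec 1 \<bullet> z 0" for y
  proof -
    have "y - zs \<in> V" using y(2) sum_zs unfolding V_def by (simp add: inner_diff_right)
    then have "g zs + (1 - \<epsilon>) / 2 * (norm (y - zs))\<^sup>2 \<le> g y" using lower[of y zs] zs(2) by simp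
    moreover have "g y \<le> g zs" using y(1) unfolding is_arg_min_def by (simp add: not_less)
    ultimately have "(1 - \<epsilon>) / 2 * (norm (y - zs))\<^sup>2 \<le> 0" by simp
    then show ?thesis using assms(13) by (simp add: mult_le_0_iff)
  qed
  ultimately show ?thesis using zs(1) by blast
qed

end
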